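(* Let $W=(w(n))_{n\geq 1}$ be the infinite sequence over $\{1,2\}$ defined in the context and let $\theta=\sum_{n\geq 1}w(n)T^{-n}\in \mathbb{Q}((T^{-1}))$. Then $\theta$ is irrational (i.e. $\theta\notin\mathbb{Q}(T)$), and it has an infinite continued fraction expansion $\theta=[0,a_1,a_2,\dots,a_n,\dots]$ with $a_n\in \mathbb{Q}[T]$ for $n\geq 1$. Let $(\ell_n)_{n\geq 0}$ be the sequence of integers defined by $\ell_0=0$, $\ell_1=1$ and $\ell_{n+1}=2\ell_n+\ell_{n-1}+2$ for $n\geq 1$; then $\ell_n=\big((2+\sqrt{2})(1+\sqrt{2})^n+(2-\sqrt{2})(1-\sqrt{2})^n\big)/4-1$ for all $n\ge 0$. Let $d_n=\deg(a_n)$ for $n\geq 1$. Then $d_1=d_2=d_3=d_4=1$ and, for every $n\geq 1$, \[ d_{4n+1}=\frac{3\ell_n+\ell_{n-1}+1}{2},\qquad d_{4n+2}=1,\qquad d_{4n+3}=\frac{\ell_n+\ell_{n-1}+1}{2},\qquad d_{4n+4}=1. \]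
   Context: Define finite words over the alphabet $\{1,2\}$ recursively by $W_0=\epsilon$ (the empty word), $W_1=1$, and $W_n=W_{n-1}\,2\,W_{n-2}\,2\,W_{n-1}$ (concatenation) for $n\geq 2$. Each $W_n$ is a prefix of $W_{n+1}$, and $W=(w(n))_{n\geq 1}$ is the infinite sequence that begins with $W_n$ for every $n\geq 0$. $\mathbb{Q}((T^{-1}))$ is the field of formal power series in $1/T$ over $\mathbb{Q}$, whose nonzero elements are $\alpha=\sum_{k\leq k_0}c_kT^k$ with $k_0\in\mathbb{Z}$, $c_k\in\mathbb{Q}$, $c_{k_0}\neq 0$. It carries the ultrametric absolute value $|\alpha|=|T|^{k_0}$, where $|T|>1$ is a fixed real number. The continued fraction expansion $[a_0,a_1,a_2,\dots]$ of an irrational element is the one given by the usual continued fraction algorithm with integers replaced by polynomials in $\mathbb{Q}[T]$: the partial quotients $a_n$ lie in $\mathbb{Q}[T]$ and have positive degree for $n\geq 1$. *)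

theory Defs
  imports Complex_Main "HOL-Computational_Algebra.Computational_Algebra" "HOL-Library.Sublist"
begin

fun word :: "nat \<Rightarrow> nat list" where
  "word 0 = []"
| "word (Suc 0) = [1]"
| "word (Suc (Suc n)) = word (Suc n) @ [2] @ word n @ [2] @ word (Suc n)"

text \<open>
  The infinite sequence is indexed from \<open>1\<close>. Its \<open>n\<close>-th letter is read off from \<open>word n\<close>, which has
  length at least \<open>n\<close>; \<open>winf_begins_with_word\<close> below shows that the sequence begins with every
  \<open>word n\<close>. The value at \<open>0\<close> is irrelevant.
\<close>

definition winf :: "nat \<Rightarrow> nat" where
  "winf n = word n ! (n - 1)"

lemma length_word: "n \<le> length (word n)"
  by (induction n rule: word.induct) auto

lemma prefix_word: "m \<le> n \<Longrightarrow> prefix (word m) (word n)"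
proof (induction n rule: dec_induct)
  case (step n)
  have "prefix (word n) (word (Suc n))"
    by (cases n) (simp_all add: prefixI)
  with step.IH show ?case
    by (rule prefix_order.trans)
qed simp

lemma winf_begins_with_word:
  assumes "i < length (word n)"
  shows "winf (Suc i) = word n ! i"
proof -
  have *: "word m ! i = word k ! i" if "m \<le> k" "i < length (word m)" for m k
    using prefix_word[OF that(1)] that(2) by (auto simp: prefix_def nth_append)
  have "i < length (word (Suc i))"
    using length_word[of "Suc i"] by simp
  then show ?thesis
    using *[of n "Suc i"] *[of "Suc i" n] assms
    unfolding winf_def diff_Suc_1 by (metis nat_le_linear)
qed

text \<open>
  The field \<open>\<rat>((T\<^sup>-\<^sup>1))\<close> is \<^typ>\<open>rat fls\<close> with the indeterminate \<^const>\<open>fls_X\<close> playing the role of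
  \<open>T\<^sup>-\<^sup>1\<close>; hence \<open>T\<close> is \<^const>\<open>fls_X_inv\<close>, and \<open>fls_nth \<alpha> k\<close> is the coefficient of \<open>T\<^sup>-\<^sup>k\<close> in \<open>\<alpha>\<close>. The
  metric of \<^typ>\<open>rat fls\<close> is the one given by the absolute value with \<open>|T| = 2\<close>; the topology
  does not depend on the choice of \<open>|T| > 1\<close>.
\<close>

definition of_poly_T :: "rat poly \<Rightarrow> rat fls" where
  "of_poly_T p = poly (map_poly fls_const p) fls_X_inv"

definition rational_functions_T :: "rat fls set" where
  "rational_functions_T = {of_poly_T p / of_poly_T q | p q. q \<noteq> 0}"

definition theta :: "rat fls" where
  "theta = fps_to_fls (Abs_fps (\<lambda>n. if n = 0 then 0 else of_nat (winf n)))"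

text \<open>
  The polynomial part of a series. The library's \<^const>\<open>fls_prpart\<close> omits the constant term.
\<close>

definition poly_part :: "rat fls \<Rightarrow> rat poly" where
  "poly_part \<alpha> = fls_prpart \<alpha> + [:fls_nth \<alpha> 0:]"

lemma coeff_poly_part: "coeff (poly_part \<alpha>) n = fls_nth \<alpha> (- int n)"
  by (cases n) (auto simp: poly_part_def)

text \<open>
  The continued fraction algorithm: complete quotients and partial quotients. The algorithm
  terminates at step \<open>n\<close> iff the \<open>n\<close>-th complete quotient is a polynomial; after that the values
  below are meaningless (\<open>inverse 0 = 0\<close>).
\<close>

fun complete_quot :: "rat fls \<Rightarrow> nat \<Rightarrow> rat fls" where
  "complete_quot \<alpha> 0 = \<alpha>"
| "complete_quot \<alpha> (Suc n) =
     inverse (complete_quot \<alpha> n - of_poly_T (poly_part (complete_quot \<alpha> n)))"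

definition partial_quot :: "rat fls \<Rightarrow> nat \<Rightarrow> rat poly" where
  "partial_quot \<alpha> n = poly_part (complete_quot \<alpha> n)"

definition cf_infinite :: "rat fls \<Rightarrow> bool" where
  "cf_infinite \<alpha> \<longleftrightarrow> (\<forall>n. complete_quot \<alpha> n \<noteq> of_poly_T (partial_quot \<alpha> n))"

text \<open>The finite continued fraction \<open>[a m, a (m + 1), \<dots>, a (m + n)]\<close>.\<close>

fun finite_cf :: "(nat \<Rightarrow> rat poly) \<Rightarrow> nat \<Rightarrow> nat \<Rightarrow> rat fls" where
  "finite_cf a m 0 = of_poly_T (a m)"
| "finite_cf a m (Suc n) = of_poly_T (a m) + inverse (finite_cf a (Suc m) n)"

fun ell :: "nat \<Rightarrow> int" where
  "ell 0 = 0"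
| "ell (Suc 0) = 1"
| "ell (Suc (Suc n)) = 2 * ell (Suc n) + ell n + 2"

end

theory Submission
  imports Defs
begin

text \<open>
  Put \<open>U\<^sub>n = W\<^sub>n 2\<close>, so that \<open>U\<^bsub>n+2\<^esub> = U\<^bsub>n+1\<^esub> U\<^sub>n U\<^bsub>n+1\<^esub>\<close>, and let \<open>s\<^sub>n\<close> be the total length of
  \<open>U\<^sub>0, \<dots>, U\<^bsub>n-1\<^esub>\<close>. The words \<open>U\<^sub>n U\<^bsub>n+1\<^esub>\<close> and \<open>U\<^bsub>n+1\<^esub> U\<^sub>n\<close> differ exactly by a transposition of two
  adjacent letters, the first \<open>s\<^bsub>n+1\<^esub> - 1\<close> letters being common. This determines how long \<open>W\<close>
  agrees with two (eventually) periodic sequences: one of period \<open>U\<^bsub>n+1\<^esub> U\<^sub>n\<close>, and one of period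
  length \<open>|U\<^sub>n|\<close> after a preperiod of length \<open>s\<^sub>n + 1\<close>. The resulting rational approximations of
  \<open>\<theta>\<close> have denominators divisible by \<open>T - 1\<close>, and a combination of two neighbours can be divided by
  \<open>T - 1\<close>, which gives the convergents in between. A sequence of approximations \<open>P\<^sub>k / Q\<^sub>k\<close> such that
  \<open>|Q\<^sub>k \<theta> - P\<^sub>k| = 1 / |Q\<^bsub>k+1\<^esub>|\<close> for all \<open>k\<close>, where \<open>|Q\<^sub>k|\<close> increases from \<open>1\<close>, consists of all the
  convergents, because the determinants \<open>P\<^sub>k Q\<^bsub>k+1\<^esub> - P\<^bsub>k+1\<^esub> Q\<^sub>k\<close> then have degree \<open>0\<close>.
\<close>

subsection \<open>Laurent series and polynomials in \<open>T\<close>\<close>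

lemma of_poly_T_0 [simp]: "of_poly_T 0 = 0"
  by (simp add: of_poly_T_def)

lemma of_poly_T_pCons: "of_poly_T (pCons a p) = fls_const a + fls_X_inv * of_poly_T p"
  by (simp add: of_poly_T_def map_poly_pCons)

lemma of_poly_T_const [simp]: "of_poly_T [:a:] = fls_const a"
  by (simp add: of_poly_T_pCons)

lemma of_poly_T_1 [simp]: "of_poly_T 1 = 1"
  using of_poly_T_const[of 1] by (simp add: one_pCons)

lemma of_poly_T_add [simp]: "of_poly_T (p + q) = of_poly_T p + of_poly_T q"
proof (induction p arbitrary: q)
  case (pCons a p)
  obtain b r where "q = pCons b r"
    by (cases q)
  then show ?case
    by (simp add: of_poly_T_pCons pCons.IH distrib_left add_ac flip: fls_plus_const)
qed simp

lemma of_poly_T_smult [simp]: "of_poly_T (smult c p) = fls_const c * of_poly_T p"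
  by (induction p) (simp_all add: of_poly_T_pCons algebra_simps flip: fls_const_mult_const)

lemma of_poly_T_uminus [simp]: "of_poly_T (- p) = - of_poly_T p"
  using of_poly_T_add[of p "- p"] by (simp add: eq_neg_iff_add_eq_0 add.commute)

lemma of_poly_T_diff [simp]: "of_poly_T (p - q) = of_poly_T p - of_poly_T q"
  using of_poly_T_add[of p "- q"] by simp

lemma of_poly_T_mult [simp]: "of_poly_T (p * q) = of_poly_T p * of_poly_T q"
proof (induction p)
  case (pCons a p)
  have "of_poly_T (pCons 0 (p * q)) = fls_X_inv * of_poly_T (p * q)"
    by (simp add: of_poly_T_pCons)
  then show ?case
    by (simp add: of_poly_T_pCons[of a p] pCons.IH algebra_simps)
qed simp

lemma fls_nth_of_poly_T: "fls_nth (of_poly_T p) k = (if k \<le> 0 then coeff p (nat (- k)) else 0)"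
proof (induction p arbitrary: k)
  case (pCons a p)
  show ?case
    by (auto simp: of_poly_T_pCons fls_X_inv_times_conv_shift pCons.IH coeff_pCons
        nat_diff_distrib' Suc_nat_eq_nat_zadd1 split: nat.split
        intro!: arg_cong[of _ _ "coeff p"])
qed simp

lemma of_poly_T_eq_0_iff [simp]: "of_poly_T p = 0 \<longleftrightarrow> p = 0"
proof
  assume "of_poly_T p = 0"
  then have "coeff p n = 0" for n
    using fls_nth_of_poly_T[of p "- int n"] by simp
  then show "p = 0"
    by (simp add: poly_eq_iff)
qed simp

lemma fls_subdegree_of_poly_T [simp]: "fls_subdegree (of_poly_T p) = - int (degree p)"
proof (cases "p = 0")
  case False
  then show ?thesis
    by (intro fls_subdegree_eqI) (auto simp: fls_nth_of_poly_T intro!: coeff_eq_0)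
qed simp

lemma fls_nth_minus_poly_part: "k \<le> 0 \<Longrightarrow> fls_nth (\<alpha> - of_poly_T (poly_part \<alpha>)) k = 0"
  by (simp add: fls_nth_of_poly_T coeff_poly_part)

lemma poly_part_eqI:
  assumes "\<And>k. k \<le> 0 \<Longrightarrow> fls_nth (\<alpha> - of_poly_T p) k = 0"
  shows "poly_part \<alpha> = p"
proof (rule poly_eqI)
  fix n
  show "coeff (poly_part \<alpha>) n = coeff p n"
    using assms[of "- int n"] by (simp add: coeff_poly_part fls_nth_of_poly_T)
qed

lemma degree_poly_part:
  assumes "fls_subdegree \<alpha> < 0"
  shows "int (degree (poly_part \<alpha>)) = - fls_subdegree \<alpha>"
proof -
  have "degree (fls_prpart \<alpha> + [:fls_nth \<alpha> 0:]) = degree (fls_prpart \<alpha>)"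
    using assms by (intro degree_add_eq_left) simp
  then show ?thesis
    using assms by (simp add: poly_part_def)
qed

lemma LIMSEQ_flsI:
  fixes f :: "nat \<Rightarrow> 'a :: group_add fls"
  assumes "\<And>n k. k \<le> int n \<Longrightarrow> fls_nth (f n - L) k = 0"
  shows "f \<longlonglongrightarrow> L"
proof (rule metric_LIMSEQ_I)
  fix r :: real
  assume "r > 0"
  then obtain N where N: "inverse (2 ^ N) < r"
    using real_arch_pow_inv[of r "1/2"] by (auto simp: power_one_over inverse_eq_divide)
  show "\<exists>no. \<forall>n\<ge>no. dist (f n) L < r"
  proof (intro exI allI impI)
    fix n
    assume n: "n \<ge> N"
    show "dist (f n) L < r"
    proof (cases "f n = L")
      case False
      then have deg: "fls_subdegree (f n - L) > int n"
        using assms by (intro fls_subdegree_greaterI) auto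
      then have "dist (f n) L = inverse (2 ^ nat (fls_subdegree (f n - L)))"
        using False by (simp add: dist_fls_def)
      also have "\<dots> \<le> inverse (2 ^ N)"
        using deg n by (intro le_imp_inverse_le power_increasing) auto
      finally show ?thesis
        using N by simp
    qed (use \<open>r > 0\<close> in simp)
  qed
qed

subsection \<open>Continued fractions from good approximations\<close>

lemma complete_quot_eq:
  "complete_quot \<alpha> m = of_poly_T (partial_quot \<alpha> m) + inverse (complete_quot \<alpha> (Suc m))"
  by (simp add: partial_quot_def)

text \<open>In the step, \<open>1/F - 1/G = (G - F) / (F * G)\<close>, and both \<open>F\<close> and
  \<open>G\<close> have negative subdegree, so one more level gains at least two coefficients of
  agreement; the claim needs only one.\<close>

lemma finite_cf_nth:
  assumes "\<And>m. fls_subdegree (complete_quot \<alpha> (Suc m)) < 0" and "k \<le> int n"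
  shows "fls_nth (finite_cf (partial_quot \<alpha>) m n - complete_quot \<alpha> m) k = 0"
  using assms(2)
proof (induction n arbitrary: m k)
  case 0
  then show ?case
    using fls_nth_minus_poly_part[of k "complete_quot \<alpha> m"] by (simp add: partial_quot_def)
next
  case (Suc n)
  define F where "F = finite_cf (partial_quot \<alpha>) (Suc m) n"
  define G where "G = complete_quot \<alpha> (Suc m)"
  have FG: "fls_nth (F - G) j = 0" if "j \<le> int n" for j
    using Suc.IH that by (simp add: F_def G_def)
  have G: "fls_subdegree G < 0"
    using assms(1) by (simp add: G_def)
  have eq: "finite_cf (partial_quot \<alpha>) m (Suc n) - complete_quot \<alpha> m = inverse F - inverse G"
    using complete_quot_eq[of \<alpha> m] by (simp add: F_def G_def del: complete_quot.simps)
  show ?case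
  proof (cases "F = G")
    case False
    have "fls_nth F j = fls_nth G j" if "j \<le> 0" for j
      using FG[of j] that by simp
    moreover have "G \<noteq> 0"
      using G by auto
    ultimately have F: "fls_subdegree F = fls_subdegree G"
      using G by (intro fls_subdegree_eqI) auto
    have [simp]: "F \<noteq> 0" "G \<noteq> 0"
      using F G by auto
    have "fls_subdegree (F - G) \<ge> int n + 1"
      using FG False by (intro fls_subdegree_geI) auto
    then have "k < fls_subdegree (G - F) - fls_subdegree F - fls_subdegree G"
      using G F Suc.prems by (simp add: fls_subdegree_minus_sym)
    also have "\<dots> = fls_subdegree ((G - F) / (F * G))"
      using False by (simp add: fls_divide_subdegree)
    also have "(G - F) / (F * G) = inverse F - inverse G"
      by (simp add: field_simps)
    finally show ?thesis
      unfolding eq by (rule fls_eq0_below_subdegree)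
  qed (unfold eq, simp)
qed

text \<open>
  \<open>P k / Q k\<close> are the convergents up to common constant factors. The recursion of the complete
  quotients is read off from the remainders \<open>Q k * \<alpha> - P k\<close>, preceded by \<open>1\<close> (which is
  \<open>Q * \<alpha> - P\<close> for \<open>P = -1\<close>, \<open>Q = 0\<close>).
\<close>

locale good_approximations =
  fixes \<alpha> :: "rat fls" and P Q :: "nat \<Rightarrow> rat poly" and D :: "nat \<Rightarrow> nat"
  assumes D_0: "D 0 = 0" and D_strict: "strict_mono D"
    and Q_nonzero: "Q k \<noteq> 0" and degree_Q: "degree (Q k) = D k"
    and remainder_nonzero: "of_poly_T (Q k) * \<alpha> - of_poly_T (P k) \<noteq> 0"
    and subdegree_remainder:
      "fls_subdegree (of_poly_T (Q k) * \<alpha> - of_poly_T (P k)) = int (D (Suc k))"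
begin

definition remainder :: "nat \<Rightarrow> rat fls" where
  "remainder k = (case k of 0 \<Rightarrow> 1 | Suc j \<Rightarrow> of_poly_T (Q j) * \<alpha> - of_poly_T (P j))"

lemma remainder_0: "remainder 0 = 1"
  and remainder_Suc: "remainder (Suc k) = of_poly_T (Q k) * \<alpha> - of_poly_T (P k)"
  by (simp_all add: remainder_def)

lemma remainder_neq_0 [simp]: "remainder k \<noteq> 0"
  by (cases k) (use remainder_nonzero in \<open>simp_all add: remainder_0 remainder_Suc\<close>)

lemma fls_subdegree_remainder [simp]: "fls_subdegree (remainder k) = int (D k)"
  by (cases k) (simp_all add: remainder_0 remainder_Suc subdegree_remainder D_0)

lemma D_less: "D k < D (Suc k)"
  using D_strict by (simp add: strict_mono_Suc_iff)

text \<open>The determinant is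
  \<open>Q k * remainder (k + 2) - Q (k + 1) * remainder (k + 1)\<close>, whose terms have
  subdegrees \<open>D (k + 2) - D k > 0\<close> and 0. A nonzero polynomial of subdegree 0 is a
  constant.\<close>

lemma determinant_const:
  obtains c where "c \<noteq> 0" "P k * Q (Suc k) - P (Suc k) * Q k = [:c:]"
proof -
  define p where "p = P k * Q (Suc k) - P (Suc k) * Q k"
  have eq: "of_poly_T p = of_poly_T (Q k) * remainder (Suc (Suc k))
      - of_poly_T (Q (Suc k)) * remainder (Suc k)"
    by (simp add: p_def remainder_Suc algebra_simps)
  have "fls_subdegree (of_poly_T (Q k) * remainder (Suc (Suc k))) > 0"
    and "fls_subdegree (of_poly_T (Q (Suc k)) * remainder (Suc k)) = 0"
    using D_less[of k] D_less[of "Suc k"] by (simp_all add: Q_nonzero degree_Q)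
  moreover from this have
    "of_poly_T (Q k) * remainder (Suc (Suc k)) \<noteq> of_poly_T (Q (Suc k)) * remainder (Suc k)"
    by (metis less_irrefl)
  ultimately have "of_poly_T p \<noteq> 0 \<and> fls_subdegree (of_poly_T p) = 0"
    unfolding eq by (subst fls_subdegree_diff_eq2) (auto simp: Q_nonzero)
  then have "p \<noteq> 0" "degree p = 0"
    by simp_all
  then obtain c where c: "p = [:c:]"
    by (metis degree_eq_zeroE)
  show ?thesis
  proof (rule that)
    show "c \<noteq> 0"
      using \<open>p \<noteq> 0\<close> c by auto
    show "P k * Q (Suc k) - P (Suc k) * Q k = [:c:]"
      using c by (simp only: p_def)
  qed
qed

text \<open>Cramer's rule: three consecutive pairs \<open>(P, Q)\<close> are linearly dependent,
  with their 2 x 2 determinants as coefficients, and the determinants of neighbouring pairs are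
  constants.\<close>

lemma remainder_recursion:
  obtains A c where "c \<noteq> 0"
    "remainder k = of_poly_T A * remainder (Suc k) + fls_const c * remainder (Suc (Suc k))"
proof -
  obtain c where c: "c \<noteq> 0" "P k * Q (Suc k) - P (Suc k) * Q k = [:c:]"
    by (rule determinant_const)
  have c': "fls_const c = of_poly_T (P k) * of_poly_T (Q (Suc k))
      - of_poly_T (P (Suc k)) * of_poly_T (Q k)"
    using arg_cong[OF c(2), of of_poly_T] by simp
  have inv: "fls_const (inverse c) * fls_const c = 1"
    using c(1) by simp
  have "\<exists>A b. b \<noteq> 0 \<and>
    fls_const c * remainder k = of_poly_T A * remainder (Suc k) + fls_const b * remainder (Suc (Suc k))"
  proof (cases k)
    case 0
    then obtain b where b: "Q k = [:b:]"
      using degree_Q[of k] by (auto simp: D_0 elim: degree_eq_zeroE)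
    then have "b \<noteq> 0"
      using Q_nonzero[of k] by auto
    moreover have "fls_const c * remainder k =
        of_poly_T (- Q (Suc k)) * remainder (Suc k) + fls_const b * remainder (Suc (Suc k))"
      unfolding c' using b by (simp add: remainder_Suc algebra_simps) (simp add: 0 remainder_0)
    ultimately show ?thesis
      by blast
  next
    case (Suc j)
    obtain b where b: "b \<noteq> 0" "P j * Q (Suc j) - P (Suc j) * Q j = [:b:]"
      by (rule determinant_const)
    have b': "fls_const b = of_poly_T (P j) * of_poly_T (Q (Suc j))
      - of_poly_T (P (Suc j)) * of_poly_T (Q j)"
      using arg_cong[OF b(2), of of_poly_T] by simp
    have "fls_const c * remainder k = of_poly_T (P j * Q (Suc k) - P (Suc k) * Q j) * remainder (Suc k)
        + fls_const (- b) * remainder (Suc (Suc k))"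
      unfolding c' fls_const_uminus b' by (simp add: Suc remainder_Suc algebra_simps)
    then show ?thesis
      using b(1) by (intro exI[of _ "P j * Q (Suc k) - P (Suc k) * Q j"] exI[of _ "- b"]) simp
  qed
  then obtain A b where Ab: "b \<noteq> 0"
    "fls_const c * remainder k = of_poly_T A * remainder (Suc k) + fls_const b * remainder (Suc (Suc k))"
    by blast
  have "remainder k = fls_const (inverse c) * (fls_const c * remainder k)"
    using inv by (simp flip: mult.assoc)
  also have "\<dots> = of_poly_T (smult (inverse c) A) * remainder (Suc k)
      + fls_const (inverse c * b) * remainder (Suc (Suc k))"
    unfolding Ab(2) by (simp add: algebra_simps flip: fls_const_mult_const)
  finally show ?thesis
    using that[of "inverse c * b" "smult (inverse c) A"] Ab(1) c(1) by simp
qed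

text \<open>Divided by \<open>remainder (Suc k)\<close>, the recursion splits a complete quotient
  into a polynomial and a series of positive subdegree, which is one step of the algorithm. The
  constant \<open>c\<close> absorbs the free scaling of each \<open>Q k\<close>.\<close>

lemma complete_quot_Suc:
  "\<exists>c. c \<noteq> 0 \<and> complete_quot \<alpha> (Suc k) = fls_const c * remainder k / remainder (Suc k)"
proof (induction k)
  case 0
  obtain q where q: "Q 0 = [:q:]"
    using degree_Q[of 0] by (auto simp: D_0 elim: degree_eq_zeroE)
  then have [simp]: "q \<noteq> 0"
    using Q_nonzero[of 0] by auto
  have "fls_const (inverse q) * fls_const q = 1"
    by simp
  then have eq: "\<alpha> - of_poly_T (smult (inverse q) (P 0)) = fls_const (inverse q) * remainder (Suc 0)"
    by (simp add: remainder_Suc q right_diff_distrib flip: mult.assoc)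
  have "poly_part \<alpha> = smult (inverse q) (P 0)"
    unfolding eq using D_less[of 0]
    by (intro poly_part_eqI, unfold eq, intro fls_eq0_below_subdegree) simp
  then show ?case
    using eq by (intro exI[of _ q]) (simp add: remainder_0 fls_inverse_const divide_inverse)
next
  case (Suc k)
  then obtain c where c: "c \<noteq> 0"
    "complete_quot \<alpha> (Suc k) = fls_const c * remainder k / remainder (Suc k)"
    by blast
  obtain A b where Ab: "b \<noteq> 0"
    "remainder k = of_poly_T A * remainder (Suc k) + fls_const b * remainder (Suc (Suc k))"
    by (rule remainder_recursion)
  have eq: "complete_quot \<alpha> (Suc k) - of_poly_T (smult c A)
      = fls_const (c * b) * remainder (Suc (Suc k)) / remainder (Suc k)"
    unfolding c(2) Ab(2) by (simp add: field_simps flip: fls_const_mult_const)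
  have sub: "fls_subdegree (fls_const (c * b) * remainder (Suc (Suc k)) / remainder (Suc k)) > 0"
    using D_less[of "Suc k"] c(1) Ab(1) by (simp add: fls_divide_subdegree)
  have "poly_part (complete_quot \<alpha> (Suc k)) = smult c A"
    using sub by (intro poly_part_eqI, unfold eq, intro fls_eq0_below_subdegree) simp
  then have "complete_quot \<alpha> (Suc (Suc k))
      = inverse (fls_const (c * b) * remainder (Suc (Suc k)) / remainder (Suc k))"
    using eq by (simp only: complete_quot.simps)
  also have "\<dots> = fls_const (inverse (c * b)) * remainder (Suc k) / remainder (Suc (Suc k))"
    by (simp add: fls_inverse_const divide_inverse)
  finally show ?case
    using c(1) Ab(1) by (intro exI[of _ "inverse (c * b)"]) simp
qed

lemma fls_subdegree_complete_quot:
  "fls_subdegree (complete_quot \<alpha> (Suc k)) = int (D k) - int (D (Suc k))"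
  using complete_quot_Suc[of k] by (auto simp: fls_divide_subdegree simp del: complete_quot.simps)

lemma fls_subdegree_complete_quot_neg: "fls_subdegree (complete_quot \<alpha> (Suc k)) < 0"
  using D_less[of k] by (simp add: fls_subdegree_complete_quot del: complete_quot.simps)

lemma degree_partial_quot: "degree (partial_quot \<alpha> (Suc k)) = D (Suc k) - D k"
  using degree_poly_part[OF fls_subdegree_complete_quot_neg[of k]] D_less[of k]
  by (simp add: partial_quot_def fls_subdegree_complete_quot del: complete_quot.simps)

lemma cf_infinite: "cf_infinite \<alpha>"
proof -
  have "complete_quot \<alpha> (Suc n) \<noteq> 0" for n
    using fls_subdegree_complete_quot_neg[of n] by auto
  then show ?thesis
    by (auto simp: cf_infinite_def partial_quot_def)
qed

lemma finite_cf_LIMSEQ: "(\<lambda>n. finite_cf (partial_quot \<alpha>) 0 n) \<longlonglongrightarrow> \<alpha>"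
proof (rule LIMSEQ_flsI)
  fix n k
  assume "k \<le> int n"
  then show "fls_nth (finite_cf (partial_quot \<alpha>) 0 n - \<alpha>) k = 0"
    using finite_cf_nth[OF fls_subdegree_complete_quot_neg, of k n 0] by simp
qed

text \<open>For a fraction with denominator \<open>q\<close>, multiplying a remainder by
  \<open>q\<close> gives a nonzero polynomial, so every \<open>D (Suc k)\<close> would be at most
  \<open>degree q\<close>.\<close>

lemma irrational: "\<alpha> \<notin> rational_functions_T"
proof
  assume "\<alpha> \<in> rational_functions_T"
  then obtain p q where q: "q \<noteq> 0" and \<alpha>: "\<alpha> = of_poly_T p / of_poly_T q"
    by (auto simp: rational_functions_T_def)
  define k where "k = degree q"
  have q\<alpha>: "of_poly_T q * \<alpha> = of_poly_T p"
    using q by (simp add: \<alpha>)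
  have eq: "of_poly_T q * remainder (Suc k) = of_poly_T (Q k * p - P k * q)"
    using q\<alpha> by (simp add: remainder_Suc right_diff_distrib mult.left_commute mult.commute)
  have "fls_subdegree (of_poly_T q * remainder (Suc k)) \<le> 0"
    unfolding eq fls_subdegree_of_poly_T by simp
  then have "D (Suc k) \<le> degree q"
    using q by simp
  moreover have "Suc k \<le> D (Suc k)"
    using D_strict by (rule strict_mono_imp_increasing)
  ultimately show False
    by (simp add: k_def)
qed

end

text \<open>
  \<open>approximable \<alpha> d e\<close> says that \<open>|Q| = |T|\<^sup>d\<close> and \<open>|Q \<alpha> - P| = |T|\<^sup>-\<^sup>e\<close> for some polynomials
  \<open>P\<close>, \<open>Q\<close>.
\<close>

definition approximable :: "rat fls \<Rightarrow> nat \<Rightarrow> nat \<Rightarrow> bool" where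
  "approximable \<alpha> d e \<longleftrightarrow> (\<exists>P Q. Q \<noteq> 0 \<and> degree Q = d
     \<and> of_poly_T Q * \<alpha> - of_poly_T P \<noteq> 0 \<and> fls_subdegree (of_poly_T Q * \<alpha> - of_poly_T P) = int e)"

lemma good_approximations_exist:
  assumes "D 0 = 0" "strict_mono D" "\<And>k. approximable \<alpha> (D k) (D (Suc k))"
  obtains P Q where "good_approximations \<alpha> P Q D"
proof -
  have "\<forall>k. \<exists>P Q. Q \<noteq> 0 \<and> degree Q = D k
     \<and> of_poly_T Q * \<alpha> - of_poly_T P \<noteq> 0
     \<and> fls_subdegree (of_poly_T Q * \<alpha> - of_poly_T P) = int (D (Suc k))"
    using assms(3) unfolding approximable_def by blast
  then have "\<exists>P Q. \<forall>k. Q k \<noteq> 0 \<and> degree (Q k) = D k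
     \<and> of_poly_T (Q k) * \<alpha> - of_poly_T (P k) \<noteq> 0
     \<and> fls_subdegree (of_poly_T (Q k) * \<alpha> - of_poly_T (P k)) = int (D (Suc k))"
    by (simp only: choice_iff)
  then obtain P Q where "\<forall>k. Q k \<noteq> 0 \<and> degree (Q k) = D k
     \<and> of_poly_T (Q k) * \<alpha> - of_poly_T (P k) \<noteq> 0
     \<and> fls_subdegree (of_poly_T (Q k) * \<alpha> - of_poly_T (P k)) = int (D (Suc k))"
    by blast
  then have "good_approximations \<alpha> P Q D"
    using assms(1,2) by unfold_locales blast+
  then show ?thesis
    by (rule that)
qed

text \<open>
  Approximations whose denominators vanish at \<open>T = 1\<close>, while the numerators do not: a suitable
  combination of two of them is divisible by \<open>T - 1\<close>.
\<close>

definition approximable_at_1 :: "rat fls \<Rightarrow> nat \<Rightarrow> nat \<Rightarrow> bool" where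
  "approximable_at_1 \<alpha> d e \<longleftrightarrow> (\<exists>P Q. Q \<noteq> 0 \<and> degree Q = d \<and> poly Q 1 = 0 \<and> poly P 1 \<noteq> 0
     \<and> of_poly_T Q * \<alpha> - of_poly_T P \<noteq> 0 \<and> fls_subdegree (of_poly_T Q * \<alpha> - of_poly_T P) = int e)"

lemma approximable_at_1_imp_approximable: "approximable_at_1 \<alpha> d e \<Longrightarrow> approximable \<alpha> d e"
  by (auto simp: approximable_at_1_def approximable_def)

text \<open>Division by \<open>T - 1\<close> lowers the degree of the denominator by 1 and shrinks
  the remainder by the factor \<open>|T|\<close>. The conditions \<open>d < d'\<close> and
  \<open>e \<noteq> e'\<close> exclude cancellation of leading terms.\<close>

lemma approximable_combination:
  assumes "approximable_at_1 \<alpha> d e" "approximable_at_1 \<alpha> d' e'" "d < d'" "e \<noteq> e'"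
  shows "approximable \<alpha> (d' - 1) (min e e' + 1)"
proof -
  obtain P Q where PQ: "Q \<noteq> 0" "degree Q = d" "poly Q 1 = 0" "poly P 1 \<noteq> 0"
    "of_poly_T Q * \<alpha> - of_poly_T P \<noteq> 0" "fls_subdegree (of_poly_T Q * \<alpha> - of_poly_T P) = int e"
    using assms(1) unfolding approximable_at_1_def by blast
  obtain P' Q' where PQ': "Q' \<noteq> 0" "degree Q' = d'" "poly Q' 1 = 0" "poly P' 1 \<noteq> 0"
    "of_poly_T Q' * \<alpha> - of_poly_T P' \<noteq> 0" "fls_subdegree (of_poly_T Q' * \<alpha> - of_poly_T P') = int e'"
    using assms(2) unfolding approximable_at_1_def by blast
  \<comment> \<open>Chosen so that \<open>P' - smult c P\<close> vanishes at 1; the denominators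
    vanish there for any \<open>c\<close>.\<close>
  define c where "c = poly P' 1 / poly P 1"
  have c: "c \<noteq> 0"
    using PQ(4) PQ'(4) by (simp add: c_def)
  have "[:-1, 1:] dvd Q' - smult c Q"
    using PQ(3) PQ'(3) by (simp flip: poly_eq_0_iff_dvd)
  then obtain R where R: "Q' - smult c Q = [:-1, 1:] * R" ..
  have "[:-1, 1:] dvd P' - smult c P"
    using PQ(4) by (simp add: c_def flip: poly_eq_0_iff_dvd)
  then obtain S where S: "P' - smult c P = [:-1, 1:] * S" ..
  have deg: "degree (Q' - smult c Q) = d'"
    using degree_add_eq_left[of "- smult c Q" Q'] PQ(2) PQ'(2) c assms(3) by simp
  then have "R \<noteq> 0"
    using R assms(3) by auto
  then have "degree R + 1 = d'"
    using deg unfolding R by (subst (asm) degree_mult_eq) auto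
  define x where "x = fls_const c * (of_poly_T Q * \<alpha> - of_poly_T P)"
  define y where "y = of_poly_T Q' * \<alpha> - of_poly_T P'"
  define z where "z = of_poly_T R * \<alpha> - of_poly_T S"
  have x: "x \<noteq> 0" "fls_subdegree x = int e" and y: "y \<noteq> 0" "fls_subdegree y = int e'"
    using PQ(5,6) PQ'(5,6) c by (auto simp: x_def y_def)
  have "of_poly_T [:-1, 1:] * z = of_poly_T ([:-1, 1:] * R) * \<alpha> - of_poly_T ([:-1, 1:] * S)"
    by (simp only: of_poly_T_mult z_def algebra_simps)
  also have "\<dots> = y - x"
    unfolding R[symmetric] S[symmetric] by (simp add: x_def y_def algebra_simps)
  finally have z: "of_poly_T [:-1, 1:] * z = y - x" .
  have "x \<noteq> y"
    using x y assms(4) by auto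
  have "fls_subdegree (y - x) = int (min e e')"
  proof (cases "e < e'")
    case True
    then show ?thesis
      using x y by (simp add: fls_subdegree_diff_eq2)
  next
    case False
    then show ?thesis
      using x y assms(4) by (simp add: fls_subdegree_diff_eq1)
  qed
  moreover have "z \<noteq> 0"
    using z \<open>x \<noteq> y\<close> by auto
  moreover have "fls_subdegree (of_poly_T [:-1, 1:] * z) = fls_subdegree z - 1"
    using \<open>z \<noteq> 0\<close> by (subst fls_subdegree_mult) auto
  ultimately have "fls_subdegree z = int (min e e' + 1)"
    using z by simp
  then show ?thesis
    unfolding approximable_def
    using \<open>R \<noteq> 0\<close> \<open>degree R + 1 = d'\<close> \<open>z \<noteq> 0\<close>
    by (intro exI[of _ S] exI[of _ R]) (auto simp: z_def)
qed

subsection \<open>Eventually periodic sequences\<close>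

definition series :: "(nat \<Rightarrow> rat) \<Rightarrow> rat fls" where
  "series w = fps_to_fls (Abs_fps (\<lambda>n. if n = 0 then 0 else w n))"

text \<open>The polynomial part of \<open>T\<^sup>n\<close> times \<open>series w\<close>.\<close>

definition head_poly :: "(nat \<Rightarrow> rat) \<Rightarrow> nat \<Rightarrow> rat poly" where
  "head_poly w n = (\<Sum>j=1..n. monom (w j) (n - j))"

lemma fls_nth_series: "fls_nth (series w) k = (if k \<le> 0 then 0 else w (nat k))"
  by (simp add: series_def)

lemma poly_head_poly_1: "poly (head_poly w n) 1 = (\<Sum>j=1..n. w j)"
  by (simp add: head_poly_def poly_sum poly_monom)

lemma coeff_head_poly: "coeff (head_poly w n) i = (if i < n then w (n - i) else 0)"
proof -
  have "coeff (head_poly w n) i = (\<Sum>j=1..n. if j = n - i \<and> i < n then w j else 0)"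
    unfolding head_poly_def coeff_sum coeff_monom by (intro sum.cong) auto
  also have "\<dots> = (if i < n then w (n - i) else 0)"
    by (cases "i < n") (simp_all add: sum.delta)
  finally show ?thesis .
qed

lemma of_poly_T_monom: "of_poly_T (monom 1 n) = fls_X_inv ^ n"
  by (induction n) (simp_all add: monom_0 monom_Suc of_poly_T_pCons)

lemma fls_nth_series_tail:
  "fls_nth (of_poly_T (monom 1 n) * series w - of_poly_T (head_poly w n)) k =
     (if k \<le> 0 then 0 else w (nat k + n))"
  by (auto simp: of_poly_T_monom fls_X_inv_power_times_conv_shift fls_nth_series fls_nth_of_poly_T
      coeff_head_poly nat_add_distrib nat_diff_distrib' add.commute intro!: arg_cong[of _ _ w])

text \<open>Multiplying by \<open>T^(t+m) - T^t\<close> subtracts two shifts of the sequence, so the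
  remainder starts where the period \<open>m\<close>, after a preperiod of length \<open>t\<close>,
  first fails. The sum over one period is the value of the numerator at 1.\<close>

lemma approximable_series:
  assumes "m > 0" "N \<ge> 1"
    and period: "\<And>i. 1 \<le> i \<Longrightarrow> i < N \<Longrightarrow> w (i + t + m) = w (i + t)"
    and mismatch: "w (N + t + m) \<noteq> w (N + t)"
    and sum: "(\<Sum>j=t+1..t+m. w j) \<noteq> 0"
  shows "approximable_at_1 (series w) (t + m) N"
proof -
  define Q where "Q = monom 1 (t + m) - (monom 1 t :: rat poly)"
  define P where "P = head_poly w (t + m) - head_poly w t"
  have deg: "degree Q = t + m"
    using degree_add_eq_left[of "- monom 1 t" "monom (1::rat) (t + m)"] \<open>m > 0\<close>
    by (simp add: Q_def degree_monom_eq)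
  then have "Q \<noteq> 0"
    using \<open>m > 0\<close> by auto
  have "poly Q 1 = 0"
    by (simp add: Q_def poly_monom)
  have "(\<Sum>j=1..t+m. w j) = (\<Sum>j=1..t. w j) + (\<Sum>j=t+1..t+m. w j)"
    by (rule sum.ub_add_nat) simp
  then have "poly P 1 \<noteq> 0"
    using sum by (simp add: P_def poly_head_poly_1)
  have eq: "of_poly_T Q * series w - of_poly_T P
      = (of_poly_T (monom 1 (t + m)) * series w - of_poly_T (head_poly w (t + m)))
       - (of_poly_T (monom 1 t) * series w - of_poly_T (head_poly w t))"
    by (simp add: P_def Q_def algebra_simps)
  have nth: "fls_nth (of_poly_T Q * series w - of_poly_T P) k
      = (if k \<le> 0 then 0 else w (nat k + t + m) - w (nat k + t))" for k
    unfolding eq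
    by (subst fls_minus_nth) (simp add: fls_nth_series_tail add.assoc del: fls_minus_nth)
  have "fls_nth (of_poly_T Q * series w - of_poly_T P) (int N) \<noteq> 0"
    unfolding nth using \<open>N \<ge> 1\<close> mismatch by simp
  moreover have "fls_nth (of_poly_T Q * series w - of_poly_T P) k = 0" if "k < int N" for k
    unfolding nth using period[of "nat k"] that by auto
  ultimately have "fls_subdegree (of_poly_T Q * series w - of_poly_T P) = int N"
    by (rule fls_subdegree_eqI)
  moreover have "of_poly_T Q * series w - of_poly_T P \<noteq> 0"
    using \<open>fls_nth _ (int N) \<noteq> 0\<close> by (metis fls_zero_nth)
  ultimately show ?thesis
    unfolding approximable_at_1_def
    using deg \<open>Q \<noteq> 0\<close> \<open>poly Q 1 = 0\<close> \<open>poly P 1 \<noteq> 0\<close> by blast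
qed

subsection \<open>Repetitions in the sequence\<close>

definition block :: "nat \<Rightarrow> nat list" where
  "block n = word n @ [2]"

lemma block_0: "block 0 = [2]" and block_1: "block (Suc 0) = [1, 2]"
  and block_Suc_Suc: "block (Suc (Suc n)) = block (Suc n) @ block n @ block (Suc n)"
  by (simp_all add: block_def)

abbreviation block_sum :: "nat \<Rightarrow> nat" where
  "block_sum n \<equiv> \<Sum>k<n. length (block k)"

text \<open>Both products at the next level consist of a product of the current level between two
  copies of \<open>block (Suc n)\<close>. Hence the transposition persists, moved right by
  \<open>length (block (Suc n))\<close>, with \<open>a\<close> and \<open>b\<close>
  exchanged.\<close>

lemma block_almost_commute:
  "\<exists>x y a b. a \<noteq> b \<and> length x + 1 = block_sum (Suc n)
     \<and> block (Suc n) @ block n = x @ [a, b] @ y \<and> block n @ block (Suc n) = x @ [b, a] @ y"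
proof (induction n)
  case 0
  show ?case
    by (rule exI[of _ "[]"], rule exI[of _ "[2]"], rule exI[of _ 1], rule exI[of _ 2])
      (simp add: block_0 block_1)
next
  case (Suc n)
  then obtain x y a b where IH: "a \<noteq> b" "length x + 1 = block_sum (Suc n)"
    "block (Suc n) @ block n = x @ [a, b] @ y" "block n @ block (Suc n) = x @ [b, a] @ y"
    by blast
  have "block (Suc (Suc n)) @ block (Suc n)
      = block (Suc n) @ (block n @ block (Suc n)) @ block (Suc n)"
    by (simp add: block_Suc_Suc)
  also have "\<dots> = (block (Suc n) @ x) @ [b, a] @ y @ block (Suc n)"
    unfolding IH(4) by simp
  finally have 1: "block (Suc (Suc n)) @ block (Suc n)
      = (block (Suc n) @ x) @ [b, a] @ y @ block (Suc n)" .
  have "block (Suc n) @ block (Suc (Suc n))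
      = block (Suc n) @ (block (Suc n) @ block n) @ block (Suc n)"
    by (simp add: block_Suc_Suc)
  also have "\<dots> = (block (Suc n) @ x) @ [a, b] @ y @ block (Suc n)"
    unfolding IH(3) by simp
  finally have 2: "block (Suc n) @ block (Suc (Suc n))
      = (block (Suc n) @ x) @ [a, b] @ y @ block (Suc n)" .
  have 3: "length (block (Suc n) @ x) + 1 = block_sum (Suc (Suc n))"
    using IH(2) by simp
  show ?case
    by (rule exI[of _ "block (Suc n) @ x"], rule exI[of _ "y @ block (Suc n)"],
        rule exI[of _ b], rule exI[of _ a], intro conjI)
      (use 1 2 3 IH(1) in simp_all)
qed

text \<open>Converts the partial sums that measure common prefixes into lengths of single
  blocks.\<close>

lemma sum_length_block: "2 * block_sum (Suc n) + 1 = length (block n) + length (block (Suc n))"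
  by (induction n) (simp_all add: block_0 block_1 block_Suc_Suc)

lemma set_word: "set (word n) \<subseteq> {1, 2}"
  by (induction n rule: word.induct) auto

text \<open>Ensures that the sum of the letters over a period is nonzero, so that the numerators do
  not vanish at \<open>T = 1\<close>.\<close>

lemma winf_pos:
  assumes "i > 0"
  shows "winf i > 0"
proof -
  have "i - 1 < length (word i)"
    using length_word[of i] assms by simp
  then have "winf i \<in> set (word i)"
    by (simp add: winf_def)
  then show ?thesis
    using set_word[of i] by auto
qed

lemma winf_prefix:
  assumes "prefix xs (word k)" "i < length xs"
  shows "winf (Suc i) = xs ! i"
proof -
  have "i < length (word k)"
    using assms prefix_length_le[OF assms(1)] by simp
  then show ?thesis
    using assms by (auto simp: winf_begins_with_word prefix_def nth_append)
qed

lemma theta_eq_series: "theta = series (\<lambda>n. of_nat (winf n))"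
  by (simp add: theta_def series_def)

text \<open>The word \<open>z\<close> starts at offset \<open>t\<close> and again at offset
  \<open>t + m\<close>, so the period \<open>m\<close> holds for \<open>length z\<close> letters and
  breaks at the next one, where \<open>a\<close> meets \<open>b\<close>.\<close>

lemma approximable_theta_word:
  assumes "prefix (u @ z @ [a]) (word k)" "prefix (v @ z @ [b]) (word k)" "a \<noteq> b"
    and "length u = t" "length v = t + m" "m > 0"
  shows "approximable_at_1 theta (t + m) (Suc (length z))"
proof -
  have u: "winf (Suc (j + t)) = (z @ [a]) ! j" if "j < Suc (length z)" for j
    using winf_prefix[OF assms(1), of "j + t"] that assms(4) by (simp add: nth_append)
  have v: "winf (Suc (j + t + m)) = (z @ [b]) ! j" if "j < Suc (length z)" for j
    using winf_prefix[OF assms(2), of "j + t + m"] that assms(5) by (simp add: nth_append)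
  show ?thesis
    unfolding theta_eq_series
  proof (rule approximable_series)
    fix i
    assume "1 \<le> i" "i < Suc (length z)"
    then show "rat_of_nat (winf (i + t + m)) = rat_of_nat (winf (i + t))"
      using u[of "i - 1"] v[of "i - 1"] by (cases i) (simp_all add: nth_append)
  next
    show "rat_of_nat (winf (Suc (length z) + t + m)) \<noteq> rat_of_nat (winf (Suc (length z) + t))"
      using u[of "length z"] v[of "length z"] assms(3) by simp
  next
    have "(\<Sum>j=t+1..t+m. rat_of_nat (winf j)) > 0"
      using assms(6) winf_pos by (intro sum_pos) auto
    then show "(\<Sum>j=t+1..t+m. rat_of_nat (winf j)) \<noteq> 0"
      by simp
  qed (use assms in auto)
qed

text \<open>A prefix long enough to contain both occurrences of the repeated words below. It is read
  off from \<open>block (n + 3)\<close> after cancelling the final letter 2.\<close>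

lemma prefix_word_blocks:
  "prefix (block (Suc n) @ block n @ block (Suc n) @ block (Suc n) @ block (Suc n)) (word (n + 3))"
proof -
  have "word (n + 3) @ [2] = block (Suc (Suc (Suc n)))"
    by (simp add: block_def numeral_3_eq_3)
  also have "\<dots> = (block (Suc n) @ block n @ block (Suc n) @ block (Suc n) @ block (Suc n))
      @ block n @ block (Suc n)"
    by (simp add: block_Suc_Suc)
  also have "\<dots> = ((block (Suc n) @ block n @ block (Suc n) @ block (Suc n) @ block (Suc n))
      @ block n @ word (Suc n)) @ [2]"
    by (simp add: block_def)
  finally show ?thesis
    unfolding append_same_eq by (simp add: prefixI)
qed

lemma word_3: "word 3 = [1, 2, 2, 1, 2, 1, 2, 1, 2, 2, 1]"
  by (simp add: numeral_3_eq_3)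

text \<open>The approximation by the eventually periodic sequence with period \<open>block n\<close>.\<close>

lemma approximable_theta_block:
  assumes "n > 0"
  shows "approximable_at_1 theta (block_sum (Suc n) + 1) (2 * block_sum (Suc n))"
proof -
  obtain l where l: "n = Suc l"
    using assms by (auto simp: gr0_conv_Suc)
  define A B C where "A = block (Suc n)" and "B = block n" and "C = block l"
  have A: "A = B @ C @ B"
    by (simp add: A_def B_def C_def l block_Suc_Suc)
  obtain x y a b where ab: "a \<noteq> b" "length x + 1 = block_sum (Suc n)"
    "A @ B = x @ [a, b] @ y" "B @ A = x @ [b, a] @ y"
    using block_almost_commute[of n] unfolding A_def B_def by blast
  obtain x' y' a' b' where ab': "a' \<noteq> b'" "length x' + 1 = block_sum n"
    "B @ C = x' @ [a', b'] @ y'" "C @ B = x' @ [b', a'] @ y'"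
    using block_almost_commute[of l] unfolding B_def C_def l by blast
  have W: "prefix (A @ B @ A @ A @ A) (word (n + 3))"
    using prefix_word_blocks unfolding A_def B_def .
  \<comment> \<open>\<open>B @ C\<close> and \<open>C @ B\<close> agree after the transposed pair,
    so the repeated word starts with \<open>y'\<close>. It stops where \<open>B @ A\<close> and
    \<open>A @ B\<close> first differ. Its two occurrences are \<open>length B\<close>
    apart.\<close>
  have "A @ B @ A @ A @ A = (B @ C) @ B @ (B @ A) @ A @ A"
    by (simp add: A)
  also have "\<dots> = ((x' @ [a', b']) @ (y' @ B @ x) @ [b]) @ [a] @ y @ A @ A"
    unfolding ab' ab by simp
  finally have 1: "prefix ((x' @ [a', b']) @ (y' @ B @ x) @ [b]) (word (n + 3))"
    using W by (metis append_prefixD)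
  have "A @ B @ A @ A @ A = B @ (C @ B) @ B @ (A @ B) @ C @ B @ A"
    by (simp add: A)
  also have "\<dots> = ((B @ x' @ [b', a']) @ (y' @ B @ x) @ [a]) @ [b] @ y @ C @ B @ A"
    unfolding ab' ab by simp
  finally have 2: "prefix ((B @ x' @ [b', a']) @ (y' @ B @ x) @ [a]) (word (n + 3))"
    using W by (metis append_prefixD)
  have approx: "approximable_at_1 theta (block_sum n + 1 + length B) (Suc (length (y' @ B @ x)))"
    by (rule approximable_theta_word[OF 1 2]) (use ab ab' in \<open>simp_all add: B_def block_def\<close>)
  have e: "Suc (length (y' @ B @ x)) = 2 * block_sum (Suc n)"
    using arg_cong[OF ab'(3), of length] ab(2) ab'(2) sum_length_block[of l]
    by (simp add: l B_def C_def)
  have d: "block_sum n + 1 + length B = block_sum (Suc n) + 1"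
    by (simp add: B_def)
  show ?thesis
    using approx unfolding d e .
qed

text \<open>The approximation by the periodic sequence with period \<open>block (n + 1) @ block n\<close>.\<close>

lemma approximable_theta_two_blocks:
  "approximable_at_1 theta (2 * block_sum (Suc n) + 1) (block_sum (Suc (Suc n)))"
proof (cases n)
  case 0
  \<comment> \<open>There is no \<open>C\<close> for \<open>n = 0\<close>. The sequence starts with
    1 2 2 1 2 1: the word 1 2 recurs after three letters, followed first by 2 and then by 1.\<close>
  have "approximable_at_1 theta (0 + 3) (Suc (length [1::nat, 2]))"
    by (intro approximable_theta_word[of "[]" "[1, 2]" 2 3 "[1, 2, 2]" 1]) (simp_all add: word_3)
  then show ?thesis
    by (simp add: 0 block_0 block_1 lessThan_Suc)
next
  case (Suc l)
  define A B C where "A = block (Suc n)" and "B = block n" and "C = block l"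
  have A: "A = B @ C @ B"
    by (simp add: A_def B_def C_def Suc block_Suc_Suc)
  obtain x y a b where ab: "a \<noteq> b" "length x + 1 = block_sum (Suc n)"
    "A @ B = x @ [a, b] @ y" "B @ A = x @ [b, a] @ y"
    using block_almost_commute[of n] unfolding A_def B_def by blast
  have W: "prefix (A @ B @ A @ A @ A) (word (n + 3))"
    using prefix_word_blocks unfolding A_def B_def .
  \<comment> \<open>\<open>A @ x\<close> occurs at the start and again after the period
    \<open>A @ B\<close>; the two copies of \<open>x\<close> come from \<open>B @ A\<close> and
    \<open>A @ B\<close>, which continue with \<open>b\<close> and \<open>a\<close>.\<close>
  have "A @ B @ A @ A @ A = A @ (B @ A) @ A @ A"
    by simp
  also have "\<dots> = ([] @ (A @ x) @ [b]) @ [a] @ y @ A @ A"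
    unfolding ab by simp
  finally have 1: "prefix ([] @ (A @ x) @ [b]) (word (n + 3))"
    using W by (metis append_prefixD)
  have "A @ B @ A @ A @ A = A @ B @ A @ (A @ B) @ C @ B"
    by (simp add: A)
  also have "\<dots> = A @ B @ A @ (x @ [a, b] @ y) @ C @ B"
    by (simp only: ab(3))
  also have "\<dots> = ((A @ B) @ (A @ x) @ [a]) @ [b] @ y @ C @ B"
    by simp
  finally have 2: "prefix ((A @ B) @ (A @ x) @ [a]) (word (n + 3))"
    using W by (metis append_prefixD)
  have "approximable_at_1 theta (0 + length (A @ B)) (Suc (length (A @ x)))"
    by (rule approximable_theta_word[OF 1 2]) (use ab in \<open>simp_all add: B_def block_def\<close>)
  moreover have "Suc (length (A @ x)) = block_sum (Suc (Suc n))"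
    using ab(2) by (simp add: A_def)
  moreover have "length (A @ B) = 2 * block_sum (Suc n) + 1"
    unfolding sum_length_block by (simp add: A_def B_def)
  ultimately show ?thesis
    by simp
qed

subsection \<open>The convergents\<close>

text \<open>
  The degrees of the denominators of the convergents. The two families of periodic approximations
  have denominators of degrees \<open>convergent_degree (4 * n)\<close> and \<open>convergent_degree (4 * n + 2)\<close>;
  the odd indices come from \<open>approximable_combination\<close>. The formula is off for \<open>k < 3\<close>.
\<close>

definition convergent_degree :: "nat \<Rightarrow> nat" where
  "convergent_degree k = (if k < 4 then k else
     let n = k div 4; s = block_sum (Suc n)
     in [s + 1, 2 * s, 2 * s + 1, block_sum (Suc (Suc n))] ! (k mod 4))"

lemma convergent_degree_small: "k < 4 \<Longrightarrow> convergent_degree k = k"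
  by (simp add: convergent_degree_def)

lemma block_sum_2: "block_sum (Suc (Suc 0)) = 3"
  by (simp add: block_0 block_1)

lemma convergent_degree_eqs:
  assumes "n > 0"
  shows "convergent_degree (4 * n) = block_sum (Suc n) + 1"
    and "convergent_degree (4 * n + 1) = 2 * block_sum (Suc n)"
    and "convergent_degree (4 * n + 2) = 2 * block_sum (Suc n) + 1"
    and "convergent_degree (4 * n + 3) = block_sum (Suc (Suc n))"
proof -
  have "4 * n div 4 = n" "(4 * n + 1) div 4 = n" "(4 * n + 2) div 4 = n" "(4 * n + 3) div 4 = n"
    "4 * n mod 4 = 0" "(4 * n + 1) mod 4 = 1" "(4 * n + 2) mod 4 = 2" "(4 * n + 3) mod 4 = 3"
    by presburger+
  then show "convergent_degree (4 * n) = block_sum (Suc n) + 1"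
    and "convergent_degree (4 * n + 1) = 2 * block_sum (Suc n)"
    and "convergent_degree (4 * n + 2) = 2 * block_sum (Suc n) + 1"
    and "convergent_degree (4 * n + 3) = block_sum (Suc (Suc n))"
    using assms by (simp_all only: convergent_degree_def Let_def) (simp_all del: sum.lessThan_Suc)
qed

lemma convergent_degree_4: "convergent_degree 4 = 4"
  using convergent_degree_eqs(1)[of 1] by (simp add: block_sum_2 block_0 block_1)

lemma block_sum_Suc_Suc: "block_sum (Suc (Suc n)) = block_sum n + 2 * block_sum (Suc n) + 1"
  using sum_length_block[of n] by simp

lemma block_sum_pos: "n > 0 \<Longrightarrow> block_sum n > 0"
  by (cases n) (simp_all add: block_def)

lemma mod4_cases:
  fixes k :: nat
  obtains "k < 4" | n where "n > 0" "k = 4 * n" | n where "n > 0" "k = 4 * n + 1"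
  | n where "n > 0" "k = 4 * n + 2" | n where "n > 0" "k = 4 * n + 3"
proof -
  have "k = 4 * (k div 4) + k mod 4" "k mod 4 < 4" "k < 4 \<or> k div 4 > 0"
    by auto
  then have "k < 4 \<or> k div 4 > 0 \<and> (k = 4 * (k div 4) \<or> k = 4 * (k div 4) + 1
      \<or> k = 4 * (k div 4) + 2 \<or> k = 4 * (k div 4) + 3)"
    by linarith
  then show ?thesis
    using that by blast
qed

lemma strict_mono_convergent_degree: "strict_mono convergent_degree"
  unfolding strict_mono_Suc_iff
proof
  fix k
  show "convergent_degree k < convergent_degree (Suc k)"
  proof (cases k rule: mod4_cases)
    case 1
    then have "k < 3 \<or> k = 3"
      by linarith
    then show ?thesis
      using convergent_degree_4 by (elim disjE) (simp_all add: convergent_degree_small)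
  next
    case (2 n)
    have *: "Suc k = 4 * n + 1"
      using 2 by simp
    show ?thesis
      unfolding * unfolding 2(2) convergent_degree_eqs[OF \<open>n > 0\<close>]
      using block_sum_pos[of n] \<open>n > 0\<close> by (simp add: block_def)
  next
    case (3 n)
    have *: "Suc k = 4 * n + 2"
      using 3 by simp
    show ?thesis
      unfolding * unfolding 3(2) convergent_degree_eqs[OF \<open>n > 0\<close>] by simp
  next
    case (4 n)
    have *: "Suc k = 4 * n + 3"
      using 4 by simp
    show ?thesis
      unfolding * unfolding 4(2) convergent_degree_eqs[OF \<open>n > 0\<close>] block_sum_Suc_Suc
      using block_sum_pos[of n] \<open>n > 0\<close> by simp
  next
    case (5 n)
    have *: "Suc k = 4 * Suc n"
      using 5 by simp
    show ?thesis
      unfolding * unfolding 5(2) convergent_degree_eqs[OF \<open>n > 0\<close>] convergent_degree_eqs[OF zero_less_Suc]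
      by simp
  qed
qed

section \<open>The first letters and the first three convergents\<close>

lemma winf_small: "winf (Suc 0) = 1" "winf 2 = 2" "winf 3 = 2" "winf 4 = 1" "winf 5 = 2"
proof -
  have "winf (Suc i) = word 3 ! i" if "i < 5" for i
    using winf_begins_with_word[of i 3] that by (simp add: word_3)
  from this[of 0] this[of 1] this[of 2] this[of 3] this[of 4]
  show "winf (Suc 0) = 1" "winf 2 = 2" "winf 3 = 2" "winf 4 = 1" "winf 5 = 2"
    by (simp_all add: word_3 flip: numeral_2_eq_2)
qed

lemma fls_nth_theta: "fls_nth theta k = (if k \<le> 0 then 0 else of_nat (winf (nat k)))"
  by (simp add: theta_eq_series fls_nth_series)

lemma of_poly_T_pCons_mult:
  "of_poly_T (pCons a p) * f = fls_const a * f + fls_shift 1 (of_poly_T p * f)"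
  by (simp add: of_poly_T_pCons distrib_right mult.assoc flip: fls_X_inv_times_conv_shift(1))

lemma approximableI:
  assumes "Q \<noteq> 0" "degree Q = d" "fls_nth (of_poly_T Q * \<alpha> - of_poly_T P) (int e) \<noteq> 0"
    and "\<And>k. k < int e \<Longrightarrow> fls_nth (of_poly_T Q * \<alpha> - of_poly_T P) k = 0"
  shows "approximable \<alpha> d e"
proof -
  have "fls_subdegree (of_poly_T Q * \<alpha> - of_poly_T P) = int e"
    using assms(3,4) by (rule fls_subdegree_eqI)
  moreover have "of_poly_T Q * \<alpha> - of_poly_T P \<noteq> 0"
    using assms(3) by (metis fls_zero_nth)
  ultimately show ?thesis
    using assms(1,2) unfolding approximable_def by blast
qed

lemma approximable_theta_0_1: "approximable theta 0 1"
  by (rule approximableI[of 1 _ _ 0]) (simp_all add: fls_nth_theta winf_small)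

lemma approximable_theta_1_2: "approximable theta 1 2"
\<comment> \<open>\<open>T - 2\<close> is the polynomial part of \<open>1 / theta\<close>.\<close>
proof (rule approximableI[of "[:-2, 1:]" _ _ 1])
  have eq: "fls_nth (of_poly_T [:-2, 1:] * theta - of_poly_T 1) k
     = fls_nth theta (k + 1) - 2 * fls_nth theta k - (if k = 0 then 1 else 0)" for k
    unfolding of_poly_T_pCons_mult by simp
  show "fls_nth (of_poly_T [:-2, 1:] * theta - of_poly_T 1) (int 2) \<noteq> 0"
    unfolding eq by (simp add: fls_nth_theta winf_small)
  show "fls_nth (of_poly_T [:-2, 1:] * theta - of_poly_T 1) k = 0" if "k < int 2" for k
  proof -
    consider "k < 0" | "k = 0" | "k = 1"
      using \<open>k < int 2\<close> by linarith
    then show ?thesis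
      unfolding eq by cases (simp_all add: fls_nth_theta winf_small)
  qed
qed simp_all

lemma approximable_theta_2_3: "approximable theta 2 3"
\<comment> \<open>The monic quadratic \<open>Q\<close> is found by making the coefficients of
  \<open>T^-1\<close> and \<open>T^-2\<close> in \<open>Q * theta\<close> vanish; \<open>P\<close>
  is the polynomial part.\<close>
proof (rule approximableI[of "[:1, -3/2, 1:]" _ _ "[:1/2, 1:]"])
  have eq: "fls_nth (of_poly_T [:1, -3/2, 1:] * theta - of_poly_T [:1/2, 1:]) k
     = fls_nth theta (k + 2) - 3/2 * fls_nth theta (k + 1) + fls_nth theta k
        - (if k = 0 then 1/2 else if k = -1 then 1 else 0)" for k
    unfolding of_poly_T_pCons_mult by (simp add: of_poly_T_pCons)
  show "fls_nth (of_poly_T [:1, -3/2, 1:] * theta - of_poly_T [:1/2, 1:]) (int 3) \<noteq> 0"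
    unfolding eq by (simp add: fls_nth_theta winf_small)
  show "fls_nth (of_poly_T [:1, -3/2, 1:] * theta - of_poly_T [:1/2, 1:]) k = 0" if "k < int 3" for k
  proof -
    consider "k < -1" | "k = -1" | "k = 0" | "k = 1" | "k = 2"
      using \<open>k < int 3\<close> by linarith
    then show ?thesis
      unfolding eq by cases (simp_all add: fls_nth_theta winf_small)
  qed
qed simp_all

text \<open>Combines the two-block approximation for \<open>n\<close> with the one-block
  approximation for \<open>Suc n\<close>. This gives the convergent of index
  \<open>4 * n + 3\<close>, including index 3 for \<open>n = 0\<close>.\<close>

lemma approximable_theta_third:
  "approximable theta (block_sum (Suc (Suc n))) (block_sum (Suc (Suc n)) + 1)"
  using approximable_combination[OF approximable_theta_two_blocks[of n] approximable_theta_block[of "Suc n"]]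
    block_sum_Suc_Suc[of n] block_sum_pos[of "Suc n"] block_sum_pos[of "Suc (Suc n)"]
  by (simp del: sum.lessThan_Suc)

lemma approximable_theta_convergent:
  "approximable theta (convergent_degree k) (convergent_degree (Suc k))"
proof (cases k rule: mod4_cases)
  case 1
  have 3: "approximable theta 3 4"
    using approximable_theta_third[of 0] unfolding block_sum_2 by simp
  consider "k = 0" | "k = 1" | "k = 2" | "k = 3"
    using 1 by linarith
  then show ?thesis
    using 3 approximable_theta_0_1 approximable_theta_1_2 approximable_theta_2_3 convergent_degree_4
    by cases (simp_all add: convergent_degree_small numeral_2_eq_2[symmetric])
next
  case (2 n)
  have *: "Suc k = 4 * n + 1"
    using 2 by simp
  show ?thesis
    unfolding * unfolding 2(2) convergent_degree_eqs[OF \<open>n > 0\<close>]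
    using approximable_at_1_imp_approximable[OF approximable_theta_block[OF \<open>n > 0\<close>]] .
next
  case (3 n)
  have *: "Suc k = 4 * n + 2"
    using 3 by simp
  \<comment> \<open>The minimum in the combination is \<open>2 * block_sum (Suc n)\<close>, because
    \<open>block_sum (Suc (Suc n))\<close> is larger.\<close>
  show ?thesis
    unfolding * unfolding 3(2) convergent_degree_eqs[OF \<open>n > 0\<close>]
    using approximable_combination[OF approximable_theta_block[of n] approximable_theta_two_blocks[of n]]
      block_sum_Suc_Suc[of n] block_sum_pos[of n] \<open>n > 0\<close>  block_sum_pos[of "Suc n"]
    by (simp del: sum.lessThan_Suc)
next
  case (4 n)
  have *: "Suc k = 4 * n + 3"
    using 4 by simp
  show ?thesis
    unfolding * unfolding 4(2) convergent_degree_eqs[OF \<open>n > 0\<close>]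
    using approximable_at_1_imp_approximable[OF approximable_theta_two_blocks[of n]] .
next
  case (5 n)
  have *: "Suc k = 4 * Suc n"
    using 5 by simp
  show ?thesis
    unfolding * unfolding 5(2) convergent_degree_eqs[OF \<open>n > 0\<close>] convergent_degree_eqs[OF zero_less_Suc]
    by (rule approximable_theta_third)
qed

text \<open>The \<open>- 1\<close> accounts for the letter 2 that ends a block, so
  \<open>ell n\<close> is the length of \<open>word n\<close>.\<close>

lemma ell_eq_length_block: "ell n = int (length (block n)) - 1"
  by (induction n rule: ell.induct) (simp_all add: block_0 block_1 block_Suc_Suc)

text \<open>\<open>ell n + 1\<close> satisfies the homogeneous recursion with characteristic roots
  \<open>1 + sqrt 2\<close> and \<open>1 - sqrt 2\<close>.\<close>

lemma ell_closed_form: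
  "real_of_int (ell n) = ((2 + sqrt 2) * (1 + sqrt 2) ^ n + (2 - sqrt 2) * (1 - sqrt 2) ^ n) / 4 - 1"
proof (induction n rule: ell.induct)
  case (3 n)
  have p: "(1 + sqrt 2) ^ Suc (Suc n) = 2 * (1 + sqrt 2) ^ Suc n + (1 + sqrt 2) ^ n"
    and m: "(1 - sqrt 2) ^ Suc (Suc n) = 2 * (1 - sqrt 2) ^ Suc n + (1 - sqrt 2) ^ n"
    by (simp_all add: algebra_simps)
  show ?case
    unfolding ell.simps p m using 3 by (simp add: field_simps)
qed (simp_all add: algebra_simps)

theorem theorem3:
  fixes a :: "nat \<Rightarrow> rat poly" and d :: "nat \<Rightarrow> nat"
  defines "a \<equiv> partial_quot theta"
    and "d \<equiv> \<lambda>n. degree (a n)"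
  shows "theta \<notin> rational_functions_T
    \<and> cf_infinite theta
    \<and> a 0 = 0
    \<and> (\<forall>n\<ge>1. degree (a n) > 0)
    \<and> (\<lambda>n. finite_cf a 0 n) \<longlonglongrightarrow> theta
    \<and> (\<forall>n. real_of_int (ell n) =
          ((2 + sqrt 2) * (1 + sqrt 2) ^ n + (2 - sqrt 2) * (1 - sqrt 2) ^ n) / 4 - 1)
    \<and> d 1 = 1 \<and> d 2 = 1 \<and> d 3 = 1 \<and> d 4 = 1
    \<and> (\<forall>n\<ge>1.
          real (d (4 * n + 1)) = (3 * real_of_int (ell n) + real_of_int (ell (n - 1)) + 1) / 2
        \<and> d (4 * n + 2) = 1
        \<and> real (d (4 * n + 3)) = (real_of_int (ell n) + real_of_int (ell (n - 1)) + 1) / 2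
        \<and> d (4 * n + 4) = 1)"
proof -
  have "convergent_degree 0 = 0"
    by (simp add: convergent_degree_small)
  then obtain P Q where "good_approximations theta P Q convergent_degree"
    using good_approximations_exist strict_mono_convergent_degree approximable_theta_convergent
    by metis
  then interpret good_approximations theta P Q convergent_degree .
  have d: "d k = convergent_degree k - convergent_degree j" if "k = Suc j" for k j
    unfolding that by (simp add: d_def a_def degree_partial_quot)
  have "a 0 = 0"
    by (simp add: a_def partial_quot_def poly_eq_iff coeff_poly_part fls_nth_theta)
  moreover have "\<forall>n\<ge>1. degree (a n) > 0"
  proof (intro allI impI)
    fix n :: nat
    assume "n \<ge> 1"
    then show "degree (a n) > 0"
      using d[of n "n - 1"] D_less[of "n - 1"] by (simp add: d_def)
  qed
  moreover have "d 1 = 1 \<and> d 2 = 1 \<and> d 3 = 1 \<and> d 4 = 1"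
    using d[of 1 0] d[of 2 1] d[of 3 2] d[of 4 3]
    by (simp add: convergent_degree_small convergent_degree_4)
  moreover have "real (d (4 * n + 1)) = (3 * real_of_int (ell n) + real_of_int (ell (n - 1)) + 1) / 2
        \<and> d (4 * n + 2) = 1
        \<and> real (d (4 * n + 3)) = (real_of_int (ell n) + real_of_int (ell (n - 1)) + 1) / 2
        \<and> d (4 * n + 4) = 1" if "n \<ge> 1" for n
  proof -
    obtain l where l: "n = Suc l"
      using \<open>n \<ge> 1\<close> by (cases n) auto
    have "n > 0"
      using l by simp
    note D = convergent_degree_eqs[OF \<open>n > 0\<close>]
    have D4: "convergent_degree (4 * n + 4) = block_sum (Suc (Suc n)) + 1"
      using convergent_degree_eqs(1)[of "Suc n"] by (simp add: add.commute del: sum.lessThan_Suc)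
    \<comment> \<open>The degrees come out as partial sums of block lengths; this identity and the
      next express them by the lengths of \<open>block n\<close> and \<open>block (n - 1)\<close>,
      hence by \<open>ell\<close>.\<close>
    have s: "2 * block_sum n + 1 = length (block l) + length (block n)"
      unfolding l by (rule sum_length_block)
    have s': "block_sum (Suc n) = block_sum n + length (block n)"
      by simp
    have "d (4 * n + 1) + 1 = block_sum (Suc n)"
      using d[of "4 * n + 1" "4 * n"] D(1,2) s' block_sum_pos[OF \<open>n > 0\<close>] by simp
    moreover have "d (4 * n + 2) = 1"
      using d[of "4 * n + 2" "4 * n + 1"] D(2,3) by simp
    moreover have "d (4 * n + 3) = block_sum n"
      using d[of "4 * n + 3" "4 * n + 2"] D(3,4) block_sum_Suc_Suc[of n]
      by (simp del: sum.lessThan_Suc)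
    moreover have "d (4 * n + 4) = 1"
      using d[of "4 * n + 4" "4 * n + 3"] D(4) D4
      by (simp del: sum.lessThan_Suc)
    ultimately show ?thesis
      using s s' by (simp add: l ell_eq_length_block field_simps del: sum.lessThan_Suc of_nat_sum)
  qed
  ultimately show ?thesis
    using irrational cf_infinite finite_cf_LIMSEQ ell_closed_form
    unfolding a_def[symmetric] by blast
qed

end
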